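(* Let $\ell\ge3$. If $\lambda$ is an $(\ell,0)$-JM partition, then $\lambda$ is a node of $B(\Lambda_0)^L$.
   Context: Young diagrams in English notation; $(a,b)$ is the box in row $a$, column $b$, residue $b-a\bmod\ell$. Hook length $h^\lambda_{(a,b)}$: number of boxes of $\lambda$ in row $a$ weakly right of $(a,b)$ plus those in column $b$ strictly below. $\lambda$ is an $(\ell,0)$-JM partition if there are no boxes $(a,b),(a,y),(x,b)$ of $\lambda$ with $\ell\mid h^\lambda_{(a,b)}$, $\ell\nmid h^\lambda_{(a,y)}$, $\ell\nmid h^\lambda_{(x,b)}$. Removable (resp. addable) $i$-box: a box in $\lambda$ (resp. position not in $\lambda$) of residue $i$ whose removal (resp. addition) yields a partition. The ladder of $(a,b)$ is the set of positions $(c,d)$, $c,d\ge1$, with $c+(\ell-1)d=a+(\ell-1)b$; ladders are ordered left to right by increasing $c+(\ell-1)d$, within a ladder top to bottom by increasing row index. The ladder $i$-signature of $\lambda$ writes $+$ for each addable $i$-box and $-$ for each removable $i$-box, reading ladders left to right and each ladder top to bottom; repeatedly deleting adjacent "$-+$" gives $+\cdots+-\cdots-$. The box of the rightmost remaining $+$ is the ladder cogood $i$-box, and $\widehat f_i\lambda$ is $\lambda$ with it added ($0$ if none). The nodes of $B(\Lambda_0)^L$ are the partitions obtainable from the empty partition by finite sequences of the operators $\widehat f_i$, $0\le i<\ell$. *)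

theory Defs
  imports "HOL-Library.Product_Lexorder"
begin

text \<open>A partition is represented by its Young diagram in English notation, a finite set of boxes
  \<open>(row, column)\<close>; rows and columns are numbered from 1.\<close>

type_synonym box = "nat \<times> nat"

definition young_diagram :: "box set \<Rightarrow> bool" where
  "young_diagram D \<longleftrightarrow> finite D \<and>
     (\<forall>(a, b) \<in> D. 1 \<le> a \<and> 1 \<le> b \<and>
        (\<forall>c d. 1 \<le> c \<and> c \<le> a \<and> 1 \<le> d \<and> d \<le> b \<longrightarrow> (c, d) \<in> D))"

definition hook_length :: "box set \<Rightarrow> box \<Rightarrow> nat" where
  "hook_length D = (\<lambda>(a, b). card {y. b \<le> y \<and> (a, y) \<in> D} + card {x. a < x \<and> (x, b) \<in> D})"

definition JM_partition :: "nat \<Rightarrow> box set \<Rightarrow> bool" where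
  "JM_partition l D \<longleftrightarrow> young_diagram D \<and>
     \<not> (\<exists>a b x y. (a, b) \<in> D \<and> (a, y) \<in> D \<and> (x, b) \<in> D \<and>
          l dvd hook_length D (a, b) \<and> \<not> l dvd hook_length D (a, y) \<and> \<not> l dvd hook_length D (x, b))"

definition residue :: "nat \<Rightarrow> box \<Rightarrow> int" where
  "residue l = (\<lambda>(a, b). (int b - int a) mod int l)"

definition removable :: "nat \<Rightarrow> nat \<Rightarrow> box set \<Rightarrow> box set" where
  "removable l i D = {p. p \<in> D \<and> residue l p = int i \<and> young_diagram (D - {p})}"

definition addable :: "nat \<Rightarrow> nat \<Rightarrow> box set \<Rightarrow> box set" where
  "addable l i D = {p. p \<notin> D \<and> residue l p = int i \<and> young_diagram (insert p D)}"

text \<open>Two positions lie on the same ladder iff their ladder numbers agree. Under the lexicographic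
  order on pairs, \<open>ladder_key\<close> orders positions by ladder, left to right, and top to bottom within
  a ladder. For \<open>l \<ge> 1\<close> no truncation occurs, and for \<open>l \<ge> 2\<close> the key is injective.\<close>

definition ladder_number :: "nat \<Rightarrow> box \<Rightarrow> nat" where
  "ladder_number l = (\<lambda>(c, d). c + (l - 1) * d)"

definition ladder_key :: "nat \<Rightarrow> box \<Rightarrow> nat \<times> nat" where
  "ladder_key l p = (ladder_number l p, fst p)"

text \<open>Each sign of a signature is kept together with the box it comes from.\<close>

datatype sign = Plus | Minus

definition ladder_signature :: "nat \<Rightarrow> nat \<Rightarrow> box set \<Rightarrow> (sign \<times> box) list" where
  "ladder_signature l i D =
     map (\<lambda>p. (if p \<in> addable l i D then Plus else Minus, p))
       (sorted_key_list_of_set (ladder_key l) (addable l i D \<union> removable l i D))"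

text \<open>For \<open>l \<ge> 2\<close> and a Young diagram, the list underlying the signature enumerates exactly the
  addable and removable boxes in strictly increasing ladder order.\<close>

lemma finite_corners:
  assumes "young_diagram D"
  shows "finite (addable l i D \<union> removable l i D)"
proof -
  have D: "finite D" using assms by (simp add: young_diagram_def)
  have "addable l i D \<subseteq> insert (1,1) ((\<lambda>(a, b). (Suc a, b)) ` D \<union> (\<lambda>(a, b). (a, Suc b)) ` D)"
  proof
    fix p assume p: "p \<in> addable l i D"
    obtain a b where ab: "p = (a, b)" by (cases p)
    have y: "young_diagram (insert (a, b) D)" using p ab by (simp add: addable_def)
    then have c: "1 \<le> a" "1 \<le> b" and
      d: "\<And>c d. 1 \<le> c \<Longrightarrow> c \<le> a \<Longrightarrow> 1 \<le> d \<Longrightarrow> d \<le> b \<Longrightarrow> (c, d) \<in> insert (a, b) D"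
      unfolding young_diagram_def by blast+
    show "p \<in> insert (1,1) ((\<lambda>(a, b). (Suc a, b)) ` D \<union> (\<lambda>(a, b). (a, Suc b)) ` D)"
    proof (cases "a = 1")
      case True
      show ?thesis
      proof (cases "b = 1")
        case False
        then have "(a, b - 1) \<in> D" using d[of a "b - 1"] c by fastforce
        then show ?thesis using c ab by (force intro: image_eqI[of _ _ "(a, b - 1)"])
      qed (use True ab in simp)
    next
      case False
      then have "(a - 1, b) \<in> D" using d[of "a - 1" b] c by fastforce
      then show ?thesis using c ab by (force intro: image_eqI[of _ _ "(a - 1, b)"])
    qed
  qed
  from finite_subset[OF this] D have "finite (addable l i D)" by simp
  moreover have "finite (removable l i D)" using D by (simp add: removable_def)
  ultimately show ?thesis by simp
qed

lemma ladder_sorted: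
  assumes "2 \<le> l" "finite A"
  shows "set (sorted_key_list_of_set (ladder_key l) A) = A \<and>
    sorted_wrt (<) (map (ladder_key l) (sorted_key_list_of_set (ladder_key l) A))"
proof -
  have i: "inj (ladder_key l)" using assms by (auto simp: inj_def ladder_key_def ladder_number_def)
  have ik: "linorder.insort_key (\<le>) f x xs = insort_key f x xs" for f :: "box \<Rightarrow> nat \<times> nat" and x xs
   by (induction xs) (simp_all add: linorder.insort_key.simps[OF linorder_axioms])
  have e: "linorder.sorted_key_list_of_set (\<le>) (ladder_key l) = sorted_key_list_of_set (ladder_key l)"
   unfolding sorted_key_list_of_set_def linorder.sorted_key_list_of_set_def[OF linorder_axioms]
   by (simp add: ik[abs_def])
  interpret folding_insort_key "(\<le>)" "(<)" UNIV "ladder_key l" using i by unfold_locales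
  show ?thesis using set_sorted_key_list_of_set[OF subset_UNIV assms(2)] strict_sorted_key_list_of_set[OF subset_UNIV, of A] e by simp
qed

inductive cancel :: "(sign \<times> box) list \<Rightarrow> (sign \<times> box) list \<Rightarrow> bool" where
  "cancel (us @ [(Minus, p), (Plus, q)] @ vs) (us @ vs)"

definition reduced_form :: "(sign \<times> box) list \<Rightarrow> (sign \<times> box) list" where
  "reduced_form w = (THE r. cancel\<^sup>*\<^sup>* w r \<and> (\<nexists>r'. cancel r r'))"

text \<open>The word obtained by cancelling as long as possible exists and is unique, so the definite
  description above is meaningful; \<open>reduce\<close> computes it.\<close>

fun push :: "sign \<times> box \<Rightarrow> (sign \<times> box) list \<Rightarrow> (sign \<times> box) list" where
  "push (Minus, p) ((Plus, q) # r) = r"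
| "push x r = x # r"

abbreviation reduce :: "(sign \<times> box) list \<Rightarrow> (sign \<times> box) list" where
  "reduce w \<equiv> foldr push w []"

lemma cancel_Cons: "cancel\<^sup>*\<^sup>* w r \<Longrightarrow> cancel\<^sup>*\<^sup>* (x # w) (x # r)"
proof (induction rule: rtranclp_induct)
  case (step y z)
  from step.hyps(2) have "cancel (x # y) (x # z)"
  proof cases
    case (1 us p q vs)
    then show ?thesis using cancel.intros[of "x # us" p q vs] by simp
  qed
  with step.IH show ?case by (rule rtranclp.rtrancl_into_rtrancl)
qed simp

lemma cancel_push: "cancel\<^sup>*\<^sup>* (x # r) (push x r)"
proof (cases "(x, r)" rule: push.cases)
  case (1 p q s)
  then show ?thesis using cancel.intros[of "[]" p q s] by auto
qed auto

lemma cancel_reduce: "cancel\<^sup>*\<^sup>* w (reduce w)"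
proof (induction w)
  case (Cons x w)
  from cancel_Cons[OF Cons.IH, of x] cancel_push[of x "reduce w"] show ?case by simp
qed simp

lemma reduce_cancel: "cancel w w' \<Longrightarrow> reduce w = reduce w'"
  by (induction rule: cancel.induct) simp

lemma reduce_irreducible: "\<nexists>r'. cancel r r' \<Longrightarrow> reduce r = r"
proof (induction r)
  case (Cons x r)
  have "\<nexists>r'. cancel r r'"
    using Cons.prems cancel_Cons by (metis append_Cons cancel.simps)
  with Cons.IH have r: "reduce r = r" by blast
  show ?case
  proof (cases "(x, r)" rule: push.cases)
    case (1 p q s)
    then have "cancel (x # r) s" using cancel.intros[of "[]" p q s] by simp
    with Cons.prems show ?thesis by blast
  qed (use r in auto)
qed simp

lemma push_irreducible:
  assumes "\<nexists>r'. cancel r r'"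
  shows "\<nexists>r'. cancel (push x r) r'"
proof (cases "\<exists>p q s. x = (Minus, p) \<and> r = (Plus, q) # s")
  case True
  then obtain p q s where eq: "x = (Minus, p)" "r = (Plus, q) # s" by blast
  then show ?thesis using assms by (auto simp: cancel.simps) (metis append_Cons)
next
  case False
  then have "push x r = x # r" by (cases "(x, r)" rule: push.cases) auto
  then show ?thesis using assms False by (auto simp: cancel.simps Cons_eq_append_conv)
qed

lemma reduced_form_ex1: "\<exists>!r. cancel\<^sup>*\<^sup>* w r \<and> (\<nexists>r'. cancel r r')"
proof (rule ex1I[of _ "reduce w"])
  have "\<nexists>r'. cancel (reduce w) r'"
  proof (induction w)
    case (Cons x w)
    then show ?case using push_irreducible by simp
  qed (simp add: cancel.simps)
  with cancel_reduce show "cancel\<^sup>*\<^sup>* w (reduce w) \<and> (\<nexists>r'. cancel (reduce w) r')" by blast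
next
  fix r assume r: "cancel\<^sup>*\<^sup>* w r \<and> (\<nexists>r'. cancel r r')"
  then have "cancel\<^sup>*\<^sup>* w r" by blast
  then have "reduce w = reduce r" by (induction rule: rtranclp_induct) (auto dest: reduce_cancel)
  with r show "r = reduce w" using reduce_irreducible by metis
qed

definition cogood_box :: "nat \<Rightarrow> nat \<Rightarrow> box set \<Rightarrow> box option" where
  "cogood_box l i D =
     (let ps = map snd (filter (\<lambda>(s, p). s = Plus) (reduced_form (ladder_signature l i D)))
      in if ps = [] then None else Some (last ps))"

text \<open>\<open>None\<close> plays the role of the value 0 of the crystal operator.\<close>

definition f_hat :: "nat \<Rightarrow> nat \<Rightarrow> box set \<Rightarrow> box set option" where
  "f_hat l i D = map_option (\<lambda>p. insert p D) (cogood_box l i D)"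

inductive_set ladder_crystal :: "nat \<Rightarrow> box set set" for l :: nat where
  empty: "{} \<in> ladder_crystal l"
| step: "D \<in> ladder_crystal l \<Longrightarrow> i < l \<Longrightarrow> f_hat l i D = Some E \<Longrightarrow> E \<in> ladder_crystal l"

end

theory Submission
  imports Defs
begin

text \<open>In a JM partition every addable \<open>i\<close>-box precedes every removable \<open>i\<close>-box in ladder order: if
  the removable box is the higher one, the corner where its row meets the column of the addable box
  has hook length divisible by \<open>l\<close>, so by the JM condition all hooks below this corner are divisible
  too, which makes its arm at least \<open>l - 1\<close> times as long as its column down to the addable box; the
  other case is the transpose. Hence nothing cancels in the signature, and \<open>D\<close> arises from \<open>D\<close>
  without its removable \<open>i\<close>-boxes by repeatedly applying the \<open>i\<close>-th crystal operator. On the bead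
  set of \<open>D\<close>, removing all removable \<open>i\<close>-boxes pushes beads from runner \<open>i\<close> to runner \<open>i - 1\<close>
  wherever possible, which preserves the JM condition; so induction on the size applies.\<close>

section \<open>Young diagrams: rows, columns, hook lengths and transposition\<close>

lemma young_diagramD:
  assumes "young_diagram D" "(a, b) \<in> D"
  shows "1 \<le> a" "1 \<le> b" "1 \<le> c \<Longrightarrow> c \<le> a \<Longrightarrow> 1 \<le> d \<Longrightarrow> d \<le> b \<Longrightarrow> (c, d) \<in> D"
  using assms unfolding young_diagram_def by blast+

lemma young_diagramI:
  assumes "finite D" "\<And>a b. (a, b) \<in> D \<Longrightarrow> 1 \<le> a \<and> 1 \<le> b"
    "\<And>a b c d. (a, b) \<in> D \<Longrightarrow> 1 \<le> c \<Longrightarrow> c \<le> a \<Longrightarrow> 1 \<le> d \<Longrightarrow> d \<le> b \<Longrightarrow> (c, d) \<in> D"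
  shows "young_diagram D"
  using assms unfolding young_diagram_def by blast

lemma young_diagram_converse:
  assumes "young_diagram D"
  shows "young_diagram (D\<inverse>)"
  using assms unfolding young_diagram_def by auto

definition row_length :: "box set \<Rightarrow> nat \<Rightarrow> nat" where
  "row_length D a = card {y. (a, y) \<in> D}"

text \<open>Columns are rows of the converse relation, so facts about rows transfer through
  \<open>young_diagram_converse\<close>.\<close>

abbreviation col_length :: "box set \<Rightarrow> nat \<Rightarrow> nat" where
  "col_length D \<equiv> row_length (D\<inverse>)"

lemma row_eq:
  assumes "young_diagram D"
  shows "{y. (a, y) \<in> D} = {1..row_length D a}"
proof -
  let ?S = "{y. (a, y) \<in> D}"
  have "?S \<subseteq> snd ` D" by force
  then have fin: "finite ?S"
    using assms by (meson finite_imageI finite_subset young_diagram_def)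
  have "\<exists>n. ?S = {1..n}"
  proof (cases "?S = {}")
    case True
    then show ?thesis by (intro exI[of _ 0]) simp
  next
    case False
    then have "(a, Max ?S) \<in> D" using fin Max_in by blast
    then have "(a, y) \<in> D" if "y \<in> {1..Max ?S}" for y
      using that young_diagramD(1)[OF assms, of a "Max ?S"]
        young_diagramD(3)[OF assms, of a "Max ?S" a y] by simp
    then have "{1..Max ?S} \<subseteq> ?S" by blast
    moreover have "?S \<subseteq> {1..Max ?S}"
      using Max_ge[OF fin] young_diagramD(2)[OF assms, of a] by fastforce
    ultimately show ?thesis by blast
  qed
  then obtain n where "?S = {1..n}" ..
  then show ?thesis by (simp add: row_length_def)
qed

lemma mem_iff_row:
  assumes "young_diagram D"
  shows "(a, b) \<in> D \<longleftrightarrow> 1 \<le> b \<and> b \<le> row_length D a"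
  using row_eq[OF assms, of a] by auto

lemma mem_iff_col:
  assumes "young_diagram D"
  shows "(a, b) \<in> D \<longleftrightarrow> 1 \<le> a \<and> a \<le> col_length D b"
  using mem_iff_row[OF young_diagram_converse[OF assms], of b a] by simp

lemma row_length_antimono:
  assumes "young_diagram D" "1 \<le> a" "a \<le> c"
  shows "row_length D c \<le> row_length D a"
proof (cases "row_length D c = 0")
  case False
  then have "(c, row_length D c) \<in> D" using mem_iff_row[OF assms(1)] by simp
  then have "(a, row_length D c) \<in> D"
    using young_diagramD[OF assms(1)] assms by (metis le_refl)
  then show ?thesis using mem_iff_row[OF assms(1)] by simp
qed simp

text \<open>Counting over the integers avoids truncated subtraction and prepares the congruences
  modulo \<open>l\<close>.\<close>

lemma hook_length_eq:
  assumes "young_diagram D" "(a, b) \<in> D"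
  shows "int (hook_length D (a, b)) = int (row_length D a) - int b + int (col_length D b) - int a + 1"
proof -
  have "{y. b \<le> y \<and> (a, y) \<in> D} = {b..row_length D a}"
    using mem_iff_row[OF assms(1)] young_diagramD(2)[OF assms] by auto
  moreover have "{x. a < x \<and> (x, b) \<in> D} = {a<..col_length D b}"
    using mem_iff_col[OF assms(1)] young_diagramD(1)[OF assms] by auto
  moreover have "b \<le> row_length D a" "a \<le> col_length D b"
    using assms mem_iff_row mem_iff_col by blast+
  ultimately show ?thesis by (simp add: hook_length_def)
qed

lemma hook_length_converse:
  assumes "young_diagram D" "(a, b) \<in> D"
  shows "hook_length (D\<inverse>) (b, a) = hook_length D (a, b)"
proof -
  have "(b, a) \<in> D\<inverse>" using assms(2) by simp
  from hook_length_eq[OF young_diagram_converse[OF assms(1)] this] hook_length_eq[OF assms]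
  show ?thesis by simp
qed

text \<open>Transposing preserves hook lengths and exchanges the roles of \<open>x\<close> and
  \<open>y\<close> in the forbidden configuration.\<close>

lemma JM_partition_converse:
  assumes "JM_partition l D"
  shows "JM_partition l (D\<inverse>)"
proof -
  have D: "young_diagram D" using assms by (simp add: JM_partition_def)
  note hc = hook_length_converse[OF D]
  show ?thesis
    unfolding JM_partition_def
  proof (intro conjI notI)
    show "young_diagram (D\<inverse>)" using D by (rule young_diagram_converse)
    assume "\<exists>a b x y. (a, b) \<in> D\<inverse> \<and> (a, y) \<in> D\<inverse> \<and> (x, b) \<in> D\<inverse> \<and>
      l dvd hook_length (D\<inverse>) (a, b) \<and> \<not> l dvd hook_length (D\<inverse>) (a, y) \<and>
      \<not> l dvd hook_length (D\<inverse>) (x, b)"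
    then obtain a b x y where "(b, a) \<in> D" "(y, a) \<in> D" "(b, x) \<in> D"
      "l dvd hook_length D (b, a)" "\<not> l dvd hook_length D (y, a)" "\<not> l dvd hook_length D (b, x)"
      using hc by auto
    then show False using assms unfolding JM_partition_def by blast
  qed
qed

section \<open>Removing several boxes of one residue\<close>

lemma removable_iff:
  assumes "young_diagram D"
  shows "(a, b) \<in> removable l i D \<longleftrightarrow>
    (a, b) \<in> D \<and> residue l (a, b) = int i \<and> (Suc a, b) \<notin> D \<and> (a, Suc b) \<notin> D"
proof -
  have "young_diagram (D - {(a, b)}) \<longleftrightarrow> (Suc a, b) \<notin> D \<and> (a, Suc b) \<notin> D" if ab: "(a, b) \<in> D"
  proof
    assume y: "young_diagram (D - {(a, b)})"
    have "1 \<le> a" "1 \<le> b" using young_diagramD(1,2)[OF assms ab] by auto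
    then show "(Suc a, b) \<notin> D \<and> (a, Suc b) \<notin> D"
      using young_diagramD(3)[OF y, of "Suc a" b a b] young_diagramD(3)[OF y, of a "Suc b" a b]
      by auto
  next
    assume n: "(Suc a, b) \<notin> D \<and> (a, Suc b) \<notin> D"
    \<comment> \<open>Any other box weakly southeast of \<open>(a, b)\<close> would force
      \<open>(Suc a, b)\<close> or \<open>(a, Suc b)\<close> into \<open>D\<close>.\<close>
    have max: "c = a \<and> d = b" if "(c, d) \<in> D" "a \<le> c" "b \<le> d" for c d
      using that young_diagramD(3)[OF assms that(1), of "Suc a" b]
        young_diagramD(3)[OF assms that(1), of a "Suc b"] n young_diagramD(1,2)[OF assms ab]
      by (cases "a = c"; cases "b = d") auto
    show "young_diagram (D - {(a, b)})"
    proof (rule young_diagramI)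
      show "finite (D - {(a, b)})" using assms by (simp add: young_diagram_def)
      show "1 \<le> c \<and> 1 \<le> d" if "(c, d) \<in> D - {(a, b)}" for c d
        using that young_diagramD(1,2)[OF assms, of c d] by simp
      show "(x, y) \<in> D - {(a, b)}"
        if "(c, d) \<in> D - {(a, b)}" "1 \<le> x" "x \<le> c" "1 \<le> y" "y \<le> d" for c d x y
        using that young_diagramD(3)[OF assms, of c d x y] max[of c d] by auto
    qed
  qed
  then show ?thesis by (auto simp: removable_def)
qed

lemma addable_iff:
  assumes "young_diagram D"
  shows "(a, b) \<in> addable l i D \<longleftrightarrow>
    (a, b) \<notin> D \<and> residue l (a, b) = int i \<and> 1 \<le> a \<and> 1 \<le> b \<and>
    (a = 1 \<or> (a - 1, b) \<in> D) \<and> (b = 1 \<or> (a, b - 1) \<in> D)"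
proof -
  have "young_diagram (insert (a, b) D) \<longleftrightarrow> 1 \<le> a \<and> 1 \<le> b \<and>
    (a = 1 \<or> (a - 1, b) \<in> D) \<and> (b = 1 \<or> (a, b - 1) \<in> D)" if ab: "(a, b) \<notin> D"
  proof
    assume y: "young_diagram (insert (a, b) D)"
    note yD = young_diagramD[OF y, of a b, OF insertI1]
    show "1 \<le> a \<and> 1 \<le> b \<and> (a = 1 \<or> (a - 1, b) \<in> D) \<and> (b = 1 \<or> (a, b - 1) \<in> D)"
      using yD(1,2) yD(3)[of "a - 1" b] yD(3)[of a "b - 1"]
      by (cases a; cases b) (auto simp: Suc_le_eq)
  next
    assume n: "1 \<le> a \<and> 1 \<le> b \<and> (a = 1 \<or> (a - 1, b) \<in> D) \<and> (b = 1 \<or> (a, b - 1) \<in> D)"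
    have below: "(c, d) \<in> insert (a, b) D" if "1 \<le> c" "c \<le> a" "1 \<le> d" "d \<le> b" for c d
    proof (cases "c = a")
      case True
      then show ?thesis
      proof (cases "d = b")
        case False
        then have "(a, b - 1) \<in> D" "d \<le> b - 1" using that n by auto
        then show ?thesis using young_diagramD(3)[OF assms] that by blast
      qed simp
    next
      case False
      then have "(a - 1, b) \<in> D" "c \<le> a - 1" using that n by auto
      then show ?thesis using young_diagramD(3)[OF assms] that by blast
    qed
    show "young_diagram (insert (a, b) D)"
    proof (rule young_diagramI)
      show "finite (insert (a, b) D)" using assms by (simp add: young_diagram_def)
      show "1 \<le> c \<and> 1 \<le> d" if "(c, d) \<in> insert (a, b) D" for c d
        using that n young_diagramD(1,2)[OF assms, of c d] by auto
      show "(x, y) \<in> insert (a, b) D"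
        if "(c, d) \<in> insert (a, b) D" "1 \<le> x" "x \<le> c" "1 \<le> y" "y \<le> d" for c d x y
        using that young_diagramD(3)[OF assms, of c d x y] below[of x y] by auto
    qed
  qed
  then show ?thesis by (auto simp: addable_def)
qed

lemma residue_neighbours:
  assumes "2 \<le> l"
  shows "residue l (Suc a, b) \<noteq> residue l (a, b)" "residue l (a, Suc b) \<noteq> residue l (a, b)"
proof -
  have "\<not> int l dvd 1" "\<not> int l dvd - 1" using assms by auto
  then show "residue l (Suc a, b) \<noteq> residue l (a, b)" "residue l (a, Suc b) \<noteq> residue l (a, b)"
    using assms by (auto simp: residue_def mod_eq_dvd_iff)
qed

text \<open>A removable box is the only box of \<open>D\<close> weakly to its southeast, so deleting
  it leaves no hole before a remaining box.\<close>

lemma young_diagram_diff_removable: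
  assumes "2 \<le> l" "young_diagram D" "T \<subseteq> removable l i D"
  shows "young_diagram (D - T)"
proof (rule young_diagramI)
  show "finite (D - T)" using assms by (simp add: young_diagram_def)
  show "1 \<le> a \<and> 1 \<le> b" if "(a, b) \<in> D - T" for a b
    using that young_diagramD(1,2)[OF assms(2), of a b] by simp
  fix a b c d
  assume ab: "(a, b) \<in> D - T" and cd: "1 \<le> c" "c \<le> a" "1 \<le> d" "d \<le> b"
  note D = young_diagramD(3)[OF assms(2), of a b]
  have "(c, d) \<notin> T"
  proof
    assume "(c, d) \<in> T"
    then have "(Suc c, d) \<notin> D" "(c, Suc d) \<notin> D"
      using assms removable_iff[OF assms(2)] by blast+
    then have "\<not> Suc c \<le> a" "\<not> Suc d \<le> b"
      using ab cd D[of "Suc c" d] D[of c "Suc d"] by auto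
    then have "c = a" "d = b" using cd by auto
    then show False using \<open>(c, d) \<in> T\<close> ab by simp
  qed
  then show "(c, d) \<in> D - T" using D[of c d] ab cd by auto
qed

text \<open>Addability of a position of residue \<open>i\<close> depends on that position and on its
  upper and left neighbours. The neighbours have other residues and so avoid \<open>T\<close>; only
  the boxes of \<open>T\<close> change status.\<close>

lemma addable_diff_removable:
  assumes "2 \<le> l" "young_diagram D" "T \<subseteq> removable l i D"
  shows "addable l i (D - T) = addable l i D \<union> T"
proof -
  have T: "(a, b) \<in> D" "residue l (a, b) = int i" if "(a, b) \<in> T" for a b
    using that assms removable_iff[OF assms(2)] by blast+
  have pred: "(a, b) \<notin> T" if "residue l (Suc a, b) = int i \<or> residue l (a, Suc b) = int i" for a b
    using T(2)[of a b] that residue_neighbours[OF assms(1)] by metis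
  have "(a, b) \<in> addable l i (D - T) \<longleftrightarrow> (a, b) \<in> addable l i D \<union> T" for a b
  proof (cases "residue l (a, b) = int i \<and> 1 \<le> a \<and> 1 \<le> b")
    case True
    then have "(a - 1, b) \<notin> T" "(a, b - 1) \<notin> T"
      using pred[of "a - 1" b] pred[of a "b - 1"] by auto
    moreover have "(a = 1 \<or> (a - 1, b) \<in> D) \<and> (b = 1 \<or> (a, b - 1) \<in> D)" if "(a, b) \<in> D"
      using young_diagramD(3)[OF assms(2) that, of "a - 1" b]
        young_diagramD(3)[OF assms(2) that, of a "b - 1"] True
      by (cases a; cases b) (auto simp: Suc_le_eq)
    ultimately show ?thesis
      using T[of a b] True
      by (auto simp: addable_iff[OF assms(2)] addable_iff[OF young_diagram_diff_removable[OF assms]])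
  next
    case False
    moreover have "(a, b) \<notin> T" using False T[of a b] young_diagramD(1,2)[OF assms(2)] by blast
    ultimately show ?thesis
      by (auto simp: addable_iff[OF assms(2)] addable_iff[OF young_diagram_diff_removable[OF assms]])
  qed
  then show ?thesis by auto
qed

lemma removable_diff_removable:
  assumes "2 \<le> l" "young_diagram D" "T \<subseteq> removable l i D"
  shows "removable l i (D - T) = removable l i D - T"
proof -
  have T: "residue l (a, b) = int i" if "(a, b) \<in> T" for a b
    using that assms removable_iff[OF assms(2)] by blast+
  have "(Suc a, b) \<notin> T \<and> (a, Suc b) \<notin> T" if "residue l (a, b) = int i" for a b
    using that T residue_neighbours[OF assms(1)] by metis
  then have "(a, b) \<in> removable l i (D - T) \<longleftrightarrow> (a, b) \<in> removable l i D - T" for a b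
    by (auto simp: removable_iff[OF assms(2)] removable_iff[OF young_diagram_diff_removable[OF assms]])
  then show ?thesis by auto
qed

section \<open>Signatures in which nothing cancels\<close>

lemma reduced_form_irreducible:
  assumes "\<nexists>r. cancel w r"
  shows "reduced_form w = w"
  unfolding reduced_form_def
  by (rule the1_equality[OF reduced_form_ex1]) (use assms in simp)

text \<open>By \<open>top\<close> and \<open>sep\<close> every plus precedes every minus and
  \<open>p\<close> carries the last plus, so the signature is already reduced.\<close>

lemma f_hat_eq:
  assumes "2 \<le> l" "young_diagram D" "p \<in> addable l i D"
    and top: "\<And>q. q \<in> addable l i D \<Longrightarrow> q \<noteq> p \<Longrightarrow> ladder_key l q < ladder_key l p"
    and sep: "\<And>q. q \<in> removable l i D \<Longrightarrow> ladder_key l p < ladder_key l q"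
  shows "f_hat l i D = Some (insert p D)"
proof -
  define A where "A = addable l i D"
  define xs where "xs = sorted_key_list_of_set (ladder_key l) (A \<union> removable l i D)"
  define w where "w = ladder_signature l i D"
  have xs: "set xs = A \<union> removable l i D" "sorted_wrt (<) (map (ladder_key l) xs)"
    using ladder_sorted[OF assms(1) finite_corners[OF assms(2)]] unfolding xs_def A_def by blast+
  have w: "w = map (\<lambda>p. (if p \<in> A then Plus else Minus, p)) xs"
    by (simp add: w_def ladder_signature_def xs_def A_def)
  have "\<nexists>r. cancel w r"
  proof
    assume "\<exists>r. cancel w r"
    then obtain us vs q r where "w = us @ [(Minus, q), (Plus, r)] @ vs"
      by (auto simp: cancel.simps)
    then obtain us' vs' where "xs = us' @ [q, r] @ vs'" and qr: "q \<notin> A" "r \<in> A"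
      by (auto simp: w map_eq_append_conv Cons_eq_map_conv split: if_splits)
    \<comment> \<open>An adjacent minus at \<open>q\<close> and plus at \<open>r\<close> would give
      the cycle \<open>q\<close> before \<open>r\<close>, \<open>r\<close> not after
      \<open>p\<close>, \<open>p\<close> before \<open>q\<close>.\<close>
    then have "ladder_key l q < ladder_key l r" "q \<in> removable l i D"
      using xs by (auto simp: sorted_wrt_append)
    then show False using sep[of q] top[of r] qr unfolding A_def
      by (metis order.strict_trans order.asym)
  qed
  then have "reduced_form w = w" by (rule reduced_form_irreducible)
  moreover have "map snd (filter (\<lambda>(s, p). s = Plus) w) = filter (\<lambda>p. p \<in> A) xs"
    unfolding w by (induction xs) auto
  moreover define ys where "ys = filter (\<lambda>p. p \<in> A) xs"
  ultimately have cb: "cogood_box l i D = (if ys = [] then None else Some (last ys))"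
    by (simp add: cogood_box_def w_def Let_def)
  have ys: "set ys = A" "sorted_wrt (<) (map (ladder_key l) ys)"
    using xs by (auto simp: ys_def sorted_wrt_map sorted_wrt_filter)
  then have ne: "ys \<noteq> []" using assms(3) by (auto simp: A_def)
  have "last ys = p"
  proof (rule ccontr)
    assume n: "last ys \<noteq> p"
    have "ys = butlast ys @ [last ys]" using ne by simp
    moreover from this have "p \<in> set (butlast ys)"
      using n ys(1) assms(3) unfolding A_def
      by (metis Un_iff empty_iff empty_set set_ConsD set_append)
    ultimately have "ladder_key l p < ladder_key l (last ys)"
      using ys(2) by (metis (no_types, lifting) list.set_intros(1) sorted_wrt_append sorted_wrt_map)
    moreover have "last ys \<in> addable l i D" using ne ys(1) last_in_set A_def by blast
    ultimately show False using top[OF _ n] by (metis order.asym)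
  qed
  then show ?thesis by (simp add: f_hat_def cb ne)
qed


section \<open>Hook lengths and the ladder order of addable and removable boxes\<close>

text \<open>The hook length at the corner \<open>(a, d)\<close> is the difference of the contents of
  \<open>(a, b)\<close> and \<open>(c, d)\<close>, hence divisible by \<open>l\<close>, while the
  one at \<open>(a, b)\<close> is 1. The JM condition then makes all hook lengths in column
  \<open>d\<close> divisible. They strictly increase upwards, so the one at \<open>(a, d)\<close>,
  which is \<open>(b - d) + (c - a)\<close>, is at least \<open>l\<close> times
  \<open>c - a\<close>.\<close>

lemma hook_length_ge:
  assumes "2 \<le> l" "JM_partition l D" "(a, b) \<in> removable l i D" "(c, d) \<in> addable l i D" "a < c"
  shows "d < b" "(int l - 1) * (int c - int a) \<le> int b - int d"
proof -
  have D: "young_diagram D" using assms(2) by (simp add: JM_partition_def)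
  note mr = mem_iff_row[OF D] and mc = mem_iff_col[OF D]
  have ab: "(a, b) \<in> D" "(Suc a, b) \<notin> D" "(a, Suc b) \<notin> D"
    using assms(3) removable_iff[OF D] by blast+
  have cd: "(c, d) \<notin> D" "1 \<le> c" "1 \<le> d" "(c - 1, d) \<in> D" "d = 1 \<or> (c, d - 1) \<in> D"
    using assms(4,5) young_diagramD(1)[OF D ab(1)] by (auto simp: addable_iff[OF D])
  have a1: "1 \<le> a" "1 \<le> b" using young_diagramD(1,2)[OF D ab(1)] .
  have res: "residue l (a, b) = residue l (c, d)"
    using assms(3,4) by (simp add: removable_def addable_def)
  have "d \<le> b"
  proof (rule ccontr)
    assume "\<not> d \<le> b"
    then have "(c, d - 1) \<in> D" "b \<le> d - 1" using cd(5) a1 by auto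
    then show False using young_diagramD(3)[OF D, of c "d - 1" "Suc a" b] ab(2) assms(5) a1 by simp
  qed
  \<comment> \<open>With \<open>d = b\<close> the addable box would lie directly below the removable
    one, with a different residue.\<close>
  moreover have "d \<noteq> b"
  proof
    assume "d = b"
    then have "c = Suc a"
      using young_diagramD(3)[OF D cd(4), of "Suc a" b] ab(2) assms(5) a1
      by (cases "Suc a \<le> c - 1") auto
    then show False using res residue_neighbours(1)[OF assms(1), of a b] \<open>d = b\<close> by simp
  qed
  ultimately show db: "d < b" by simp
  have in_col: "(x, d) \<in> D" if "1 \<le> x" "x < c" for x
    using young_diagramD(3)[OF D cd(4), of x d] that cd by simp
  have row_a: "row_length D a = b" using ab mr[of a b] mr[of a "Suc b"] by simp
  have col_b: "col_length D b = a" using ab mc[of a b] mc[of "Suc a" b] by simp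
  have col_d: "col_length D d = c - 1" using cd mc[of c d] mc[of "c - 1" d] by auto
  have hab: "hook_length D (a, b) = 1"
    using hook_length_eq[OF D ab(1)] row_a col_b by simp
  have had: "int (hook_length D (a, d)) = int b - int d + (int c - int a)"
    using hook_length_eq[OF D in_col[OF a1(1) assms(5)]] row_a col_d cd(2) by simp
  have "int l dvd (int b - int a) - (int d - int c)"
    using res by (simp add: residue_def mod_eq_dvd_iff)
  then have "int l dvd int (hook_length D (a, d))"
    by (simp only: had) (simp add: algebra_simps)
  then have "l dvd hook_length D (a, d)" by simp
  then have dv: "l dvd hook_length D (x, d)" if "1 \<le> x" "x < c" for x
    using assms(1,2) ab(1) hab in_col[OF that] in_col[OF a1(1) assms(5)]
    unfolding JM_partition_def by (metis nat_dvd_1_iff_1 numeral_le_one_iff semiring_norm(69))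
  \<comment> \<open>Here \<open>j\<close> counts rows upwards from the foot
    \<open>(c - 1, d)\<close>: the first positive multiple of \<open>l\<close> is at least
    \<open>l\<close>, and each strictly larger multiple gains at least \<open>l\<close>.\<close>
  have "l * Suc j \<le> hook_length D (c - Suc j, d)" if "Suc j < c" for j
    using that
  proof (induction j)
    case 0
    have "(c - 1, d) \<in> D" using in_col[of "c - 1"] 0 by simp
    then have "0 < int (hook_length D (c - 1, d))"
      using hook_length_eq[OF D, of "c - 1" d] mr[of "c - 1" d] mc[of "c - 1" d] by simp
    moreover have "l dvd hook_length D (c - 1, d)" using dv[of "c - 1"] 0 by simp
    ultimately show ?case by (auto dest: dvd_imp_le)
  next
    case (Suc j)
    define x where "x = c - Suc (Suc j)"
    have x: "c - Suc j = Suc x" "1 \<le> x" "Suc x < c" using Suc.prems by (auto simp: x_def)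
    have "int (hook_length D (Suc x, d)) < int (hook_length D (x, d))"
      using hook_length_eq[OF D, of x d] hook_length_eq[OF D, of "Suc x" d] in_col[of x]
        in_col[of "Suc x"] x row_length_antimono[OF D x(2), of "Suc x"] by simp
    then have "l * Suc j < hook_length D (x, d)" using Suc x by simp
    moreover obtain k where k: "hook_length D (x, d) = l * k" using dv[of x] x by (auto elim: dvdE)
    ultimately have "l * Suc j < l * k" by simp
    then have "Suc j < k" by (simp only: mult_less_cancel1)
    then have "l * Suc (Suc j) \<le> l * k" by (intro mult_le_mono2) simp
    then show ?case using k by (simp add: x_def)
  qed
  from this[of "c - a - 1"] have "l * (c - a) \<le> hook_length D (a, d)"
    using assms(5) a1 by (simp add: Suc_diff_Suc)
  then have "int l * (int c - int a) \<le> int (hook_length D (a, d))"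
    using assms(5) by (metis less_imp_le of_nat_diff of_nat_le_iff of_nat_mult)
  then show "(int l - 1) * (int c - int a) \<le> int b - int d"
    using had by (simp add: algebra_simps)
qed

lemma addable_before_removable:
  assumes "3 \<le> l" "JM_partition l D" "q \<in> addable l i D" "p \<in> removable l i D"
  shows "ladder_key l q < ladder_key l p"
proof -
  obtain a b c d where pq: "p = (a, b)" "q = (c, d)" by (metis surj_pair)
  have D: "young_diagram D" using assms(2) by (simp add: JM_partition_def)
  note D' = young_diagram_converse[OF D]
  have L: "int (ladder_number l (x, y)) = int x + (int l - 1) * int y" for x y
    using assms(1) by (simp add: ladder_number_def)
  consider "a < c" | "a = c" | "c < a" by linarith
  then show ?thesis
  proof cases
    case 1
    have "2 \<le> l" using assms(1) by simp
    note h = hook_length_ge[OF this assms(2) assms(4,3)[unfolded pq] 1]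
    have "1 * (int c - int a) \<le> (int l - 1) * (int c - int a)"
      using 1 assms(1) by (intro mult_right_mono) auto
    with h(2) have "int c - int a \<le> int b - int d" by simp
    \<comment> \<open>Strictness comes from \<open>3 \<le> l\<close>. It matters because on a common
      ladder the lower, addable box would be read last.\<close>
    also have "\<dots> < (int l - 1) * (int b - int d)"
      using h(1) assms(1) by simp
    finally have "int (ladder_number l (c, d)) < int (ladder_number l (a, b))"
      unfolding L by (simp add: algebra_simps)
    then show ?thesis by (simp add: pq ladder_key_def)
  next
    case 2
    have ab: "(a, b) \<in> D" "(a, Suc b) \<notin> D" and cd: "(c, d) \<notin> D" "d = 1 \<or> (c, d - 1) \<in> D" "1 \<le> d"
      using assms(3,4) pq by (simp_all add: removable_iff[OF D] addable_iff[OF D])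
    \<comment> \<open>In a common row the addable box is the right neighbour of the removable one,
      so their residues cannot agree.\<close>
    then have "d = Suc b" using 2 mem_iff_row[OF D] by auto
    then have "residue l (c, d) \<noteq> residue l (a, b)"
      using residue_neighbours(2)[of l a b] 2 assms(1) by simp
    then show ?thesis using assms(3,4) pq by (simp add: removable_def addable_def)
  next
    case 3
    \<comment> \<open>Transposing negates contents, so residue \<open>i\<close> becomes the class of
      \<open>- i\<close>.\<close>
    define i' where "i' = nat ((- int i) mod int l)"
    have res: "residue l (y, x) = int i'" if "residue l (x, y) = int i" for x y
    proof -
      have "(- (int y - int x)) mod int l = (- int i) mod int l"
        using that mod_minus_eq[of "int y - int x" "int l"] by (simp add: residue_def)
      then show ?thesis using assms(1) by (simp add: residue_def i'_def)
    qed
    have "(b, a) \<in> removable l i' (D\<inverse>)" "(d, c) \<in> addable l i' (D\<inverse>)"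
      using assms(3,4) pq res by (auto simp: removable_iff[OF D] addable_iff[OF D]
        removable_iff[OF D'] addable_iff[OF D'])
    moreover have "b < d"
    proof (rule ccontr)
      assume "\<not> b < d"
      then have "(c, d) \<in> D"
        using 3 assms(3,4) pq young_diagramD(3)[OF D, of a b c d]
        by (simp add: removable_iff[OF D] addable_iff[OF D])
      then show False using assms(3) pq by (simp add: addable_def)
    qed
    ultimately have "(int l - 1) * (int d - int b) \<le> int a - int c"
      using hook_length_ge(2)[OF _ JM_partition_converse[OF assms(2)]] assms(1) by simp
    then have "int (ladder_number l (c, d)) \<le> int (ladder_number l (a, b))"
      unfolding L by (simp add: algebra_simps)
    \<comment> \<open>The ladders may coincide here; then \<open>c < a\<close> decides.\<close>
    then show ?thesis using 3 by (auto simp: pq ladder_key_def)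
  qed
qed

section \<open>Beads and gaps of a partition\<close>

text \<open>This is the beta-set (Maya diagram) of the partition. Empty rows contribute too, so all
  sufficiently negative integers are beads and no number of parts has to be chosen.\<close>

definition beads :: "box set \<Rightarrow> int set" where
  "beads D = {int (row_length D a) - int a | a. 1 \<le> a}"

text \<open>Along the boundary of the diagram the beads are the vertical steps and the gaps the
  horizontal ones, so gaps are indexed by columns.\<close>

lemma not_in_beads_iff:
  assumes D: "young_diagram D"
  shows "y \<notin> beads D \<longleftrightarrow> (\<exists>b\<ge>1. y = int b - 1 - int (col_length D b))"
proof
  assume y: "y \<notin> beads D"
  \<comment> \<open>The first row \<open>a\<close> whose bead is at most \<open>y\<close> has its
    bead strictly below the gap \<open>y\<close>; column \<open>y + a\<close> then ends exactly in
    the row above.\<close>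
  define P where "P a \<longleftrightarrow> 1 \<le> a \<and> int (row_length D a) - int a \<le> y" for a
  have "P (row_length D 1 + nat \<bar>y\<bar> + 1)"
    using row_length_antimono[OF D, of 1 "row_length D 1 + nat \<bar>y\<bar> + 1"] by (simp add: P_def)
  then have Pa: "P (Least P)" and min: "\<And>x. x < Least P \<Longrightarrow> \<not> P x"
    by (rule LeastI) (rule not_less_Least)
  define a where "a = Least P"
  have a: "1 \<le> a" "int (row_length D a) - int a < y"
    using Pa y unfolding P_def beads_def a_def by force+
  define b where "b = nat (y + int a)"
  have b: "int b = y + int a" "1 \<le> b" "row_length D a < b" using a by (auto simp: b_def)
  have "(a, b) \<notin> D" using b mem_iff_row[OF D] by simp
  moreover have "(a - 1, b) \<in> D" if "a \<noteq> 1"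
  proof -
    have "\<not> P (a - 1)" using min[of "a - 1"] a by (simp add: a_def)
    moreover have "1 \<le> a - 1" using that a by simp
    ultimately have "y < int (row_length D (a - 1)) - int (a - 1)" by (simp add: P_def)
    then show ?thesis using that a b mem_iff_row[OF D, of "a - 1" b] by simp
  qed
  ultimately have "col_length D b = a - 1"
    using mem_iff_col[OF D, of a b] mem_iff_col[OF D, of "a - 1" b] a by (cases "a = 1") auto
  then show "\<exists>b\<ge>1. y = int b - 1 - int (col_length D b)"
    using a b by (intro exI[of _ b]) simp
next
  assume "\<exists>b\<ge>1. y = int b - 1 - int (col_length D b)"
  then obtain b where b: "1 \<le> b" "y = int b - 1 - int (col_length D b)" by blast
  \<comment> \<open>If \<open>(a, b)\<close> is a box, the bead of row \<open>a\<close> exceeds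
    \<open>y\<close>; otherwise it is smaller.\<close>
  have "y \<noteq> int (row_length D a) - int a" if "1 \<le> a" for a
    using b that mem_iff_row[OF D, of a b] mem_iff_col[OF D, of a b] by (cases "(a, b) \<in> D") auto
  then show "y \<notin> beads D" by (auto simp: beads_def)
qed

text \<open>A box of \<open>D\<close> corresponds to a bead \<open>X\<close> (its row) and a gap \<open>Y < X\<close> (its column), and its
  hook length is \<open>X - Y\<close>; so this is the JM condition for the residue map \<open>\<rho>\<close>.\<close>

definition JM_beads :: "(int \<Rightarrow> int) \<Rightarrow> int set \<Rightarrow> bool" where
  "JM_beads \<rho> B \<longleftrightarrow> \<not> (\<exists>X X' Y Y'. X \<in> B \<and> X' \<in> B \<and> Y \<notin> B \<and> Y' \<notin> B \<and>
     Y < X \<and> Y' < X \<and> Y < X' \<and> \<rho> X = \<rho> Y \<and> \<rho> X \<noteq> \<rho> Y' \<and> \<rho> X' \<noteq> \<rho> Y)"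

text \<open>The boxes \<open>(a, b)\<close>, \<open>(a, y)\<close>, \<open>(x, b)\<close> of a
  forbidden configuration become the bead-gap pairs \<open>(X, Y)\<close>, \<open>(X, Y')\<close>,
  \<open>(X', Y)\<close>.\<close>

lemma JM_partition_iff_beads:
  assumes D: "young_diagram D"
  shows "JM_partition l D \<longleftrightarrow> JM_beads (\<lambda>x. x mod int l) (beads D)"
proof -
  define \<beta> where "\<beta> a = int (row_length D a) - int a" for a
  define \<gamma> where "\<gamma> b = int b - 1 - int (col_length D b)" for b
  have B: "x \<in> beads D \<longleftrightarrow> (\<exists>a\<ge>1. x = \<beta> a)" for x by (auto simp: beads_def \<beta>_def)
  have G: "x \<notin> beads D \<longleftrightarrow> (\<exists>a\<ge>1. x = \<gamma> a)" for x using not_in_beads_iff[OF D] by (simp add: \<gamma>_def)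
  have box: "(a, b) \<in> D \<longleftrightarrow> 1 \<le> a \<and> 1 \<le> b \<and> \<gamma> b < \<beta> a" for a b
    using mem_iff_row[OF D, of a b] mem_iff_col[OF D, of a b]
    by (cases "(a, b) \<in> D") (auto simp: \<beta>_def \<gamma>_def)
  have h: "l dvd hook_length D (a, b) \<longleftrightarrow> \<beta> a mod int l = \<gamma> b mod int l" if "(a, b) \<in> D" for a b
  proof -
    have "int (hook_length D (a, b)) = \<beta> a - \<gamma> b"
      using hook_length_eq[OF D that] by (simp add: \<beta>_def \<gamma>_def)
    then show ?thesis by (metis int_dvd_int_iff mod_eq_dvd_iff)
  qed
  show ?thesis
  proof
    assume JM: "JM_partition l D"
    show "JM_beads (\<lambda>x. x mod int l) (beads D)"
      unfolding JM_beads_def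
    proof (rule notI, elim exE conjE)
      fix X X' Y Y'
      assume *: "X \<in> beads D" "X' \<in> beads D" "Y \<notin> beads D" "Y' \<notin> beads D"
        "Y < X" "Y' < X" "Y < X'" "X mod int l = Y mod int l" "X mod int l \<noteq> Y' mod int l"
        "X' mod int l \<noteq> Y mod int l"
      from * obtain a x b y where "1 \<le> a" "X = \<beta> a" "1 \<le> x" "X' = \<beta> x" "1 \<le> b" "Y = \<gamma> b"
        "1 \<le> y" "Y' = \<gamma> y"
        using B G by metis
      with * have "(a, b) \<in> D" "(a, y) \<in> D" "(x, b) \<in> D" "l dvd hook_length D (a, b)"
        "\<not> l dvd hook_length D (a, y)" "\<not> l dvd hook_length D (x, b)"
        using h box by simp_all
      with JM show False unfolding JM_partition_def by blast
    qed
  next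
    assume JM: "JM_beads (\<lambda>x. x mod int l) (beads D)"
    have False if *: "(a, b) \<in> D" "(a, y) \<in> D" "(x, b) \<in> D" "l dvd hook_length D (a, b)"
      "\<not> l dvd hook_length D (a, y)" "\<not> l dvd hook_length D (x, b)" for a b x y
    proof -
      have "\<beta> a \<in> beads D" "\<beta> x \<in> beads D" "\<gamma> b \<notin> beads D" "\<gamma> y \<notin> beads D"
        "\<gamma> b < \<beta> a" "\<gamma> y < \<beta> a" "\<gamma> b < \<beta> x"
        using * box B G by metis+
      moreover have "\<beta> a mod int l = \<gamma> b mod int l" "\<beta> a mod int l \<noteq> \<gamma> y mod int l"
        "\<beta> x mod int l \<noteq> \<gamma> b mod int l"
        using * h by blast+
      ultimately show False using JM unfolding JM_beads_def by blast
    qed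
    then show "JM_partition l D" unfolding JM_partition_def using D by blast
  qed
qed

section \<open>Moving beads from one runner to the next\<close>

text \<open>Each pair of positions \<open>x - 1\<close>, \<open>x\<close> with
  \<open>\<rho> x = i\<close> is sorted: a single bead ends at \<open>x - 1\<close>. The map
  \<open>\<rho>\<close> stays abstract because only its behaviour under \<open>x + 1\<close>
  matters.\<close>

definition shift_down :: "(int \<Rightarrow> int) \<Rightarrow> int \<Rightarrow> int set \<Rightarrow> int set" where
  "shift_down \<rho> i B = {x. if \<rho> x = i then x \<in> B \<and> x - 1 \<in> B
     else if \<rho> (x + 1) = i then x \<in> B \<or> x + 1 \<in> B else x \<in> B}"

text \<open>Following each bead to its new place is the form that matches row lengths. By
  \<open>ne\<close> a moved bead leaves class \<open>i\<close>.\<close>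

lemma shift_down_eq_image:
  assumes ne: "\<And>x. \<rho> (x + 1) \<noteq> \<rho> x"
  shows "shift_down \<rho> i B = (\<lambda>x. if \<rho> x = i \<and> x - 1 \<notin> B then x - 1 else x) ` B" (is "_ = ?f ` B")
proof (intro equalityI subsetI)
  fix x assume x: "x \<in> shift_down \<rho> i B"
  show "x \<in> ?f ` B"
  proof (cases "x \<in> B")
    case True
    then have "x = ?f x" using x by (auto simp: shift_down_def)
    then show ?thesis using True by blast
  next
    case False
    then have "\<rho> (x + 1) = i" "x + 1 \<in> B" using x by (auto simp: shift_down_def split: if_splits)
    then show ?thesis using False by (intro image_eqI[of _ _ "x + 1"]) auto
  qed
next
  fix x assume "x \<in> ?f ` B"
  then obtain y where y: "y \<in> B" "x = ?f y" by blast
  show "x \<in> shift_down \<rho> i B"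
  proof (cases "\<rho> y = i \<and> y - 1 \<notin> B")
    case True
    then have "x = y - 1" "\<rho> (y - 1) \<noteq> i" using y ne[of "y - 1"] by auto
    then show ?thesis using True y by (simp add: shift_down_def)
  next
    case False
    then show ?thesis using y by (auto simp: shift_down_def)
  qed
qed

text \<open>A forbidden configuration of the shifted set is traced back to one in \<open>B\<close>.
  The common class of \<open>X\<close> and \<open>Y\<close> is either untouched, the class that
  beads leave, or the class they enter; the last two cases are dual under exchanging beads with gaps
  and reversing the line.\<close>

lemma JM_beads_shift_down:
  assumes inj: "\<And>x y. \<rho> (x + 1) = \<rho> (y + 1) \<longleftrightarrow> \<rho> x = \<rho> y" and ne: "\<And>x. \<rho> (x + 1) \<noteq> \<rho> x"
    and JM: "JM_beads \<rho> B"
  shows "JM_beads \<rho> (shift_down \<rho> i B)"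
  unfolding JM_beads_def
proof (rule notI, elim exE conjE)
  let ?C = "shift_down \<rho> i B"
  fix X X' Y Y'
  assume X: "X \<in> ?C" and X': "X' \<in> ?C" and Y: "Y \<notin> ?C" and Y': "Y' \<notin> ?C"
    and lt: "Y < X" "Y' < X" "Y < X'" and eq: "\<rho> X = \<rho> Y" and n: "\<rho> X \<noteq> \<rho> Y'" "\<rho> X' \<noteq> \<rho> Y"
  have no: False if "P \<in> B" "Q \<notin> B" "\<rho> P = \<rho> Q" "Q < P" "Q' \<notin> B" "Q' < P" "\<rho> Q' \<noteq> \<rho> P"
    "P' \<in> B" "Q < P'" "\<rho> P' \<noteq> \<rho> Q" for P Q P' Q'
    using JM that unfolding JM_beads_def by metis
  have inj': "\<rho> (x - 1) = \<rho> (y - 1) \<longleftrightarrow> \<rho> x = \<rho> y" for x y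
    using inj[of "x - 1" "y - 1"] by simp
  have ne': "\<rho> (x - 1) \<noteq> \<rho> x" for x using ne[of "x - 1"] by simp
  note sd = shift_down_def[of \<rho> i B]
  consider "\<rho> X \<noteq> i" "\<rho> (X + 1) \<noteq> i" | "\<rho> X = i" | "\<rho> (X + 1) = i" by blast
  then show False
  proof cases
    case 1
    have XY: "X \<in> B" "Y \<notin> B" using 1 X Y eq inj[of X Y] by (auto simp: sd)
    \<comment> \<open>If \<open>Y'\<close> was a bead, it has moved to \<open>Y' - 1\<close>, which
      was a gap of \<open>B\<close>; likewise \<open>X' + 1\<close> replaces \<open>X'\<close> below
      if \<open>X'\<close> has just been filled.\<close>
    have "\<exists>Q. Q \<notin> B \<and> Q < X \<and> \<rho> Q \<noteq> \<rho> X"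
    proof (cases "Y' \<in> B")
      case True
      then have "\<rho> Y' = i" "Y' - 1 \<notin> B" using Y' by (auto simp: sd split: if_splits)
      moreover from this have "\<rho> (Y' - 1) \<noteq> \<rho> X" using 1 inj[of "Y' - 1" X] by auto
      ultimately show ?thesis using lt by (intro exI[of _ "Y' - 1"]) auto
    qed (use lt n in auto)
    moreover have "\<exists>P. P \<in> B \<and> Y < P \<and> \<rho> P \<noteq> \<rho> Y"
    proof (cases "X' \<in> B")
      case False
      then have "\<rho> (X' + 1) = i" "X' + 1 \<in> B" using X' by (auto simp: sd split: if_splits)
      then show ?thesis using 1 lt eq by (intro exI[of _ "X' + 1"]) auto
    qed (use lt n in auto)
    ultimately show False using no[OF XY eq lt(1)] by blast
  next
    case 2
    \<comment> \<open>A bead stays in class \<open>i\<close> only above another bead. If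
      \<open>Y\<close> is a gap of \<open>B\<close>, the bead \<open>X - 1\<close> replaces
      \<open>X'\<close>; otherwise the pair \<open>(X - 1, Y - 1)\<close> is used, with the bead
      \<open>X\<close> in place of \<open>X'\<close>.\<close>
    have B: "X \<in> B" "X - 1 \<in> B" using X 2 by (auto simp: sd)
    have eq1: "\<rho> (X - 1) = \<rho> (Y - 1)" using inj'[of X Y] eq by blast
    have Y'i: "\<rho> Y' \<noteq> i" using n 2 by simp
    then have Y'B: "Y' \<notin> B" "\<rho> (Y' + 1) = i \<longrightarrow> Y' + 1 \<notin> B"
      using Y' by (auto simp: sd split: if_splits)
    show False
    proof (cases "Y \<in> B")
      case False
      have "Y \<noteq> X - 1" using eq ne'[of X] by metis
      then have "Y < X - 1" using lt by simp
      then show False using no[OF B(1) False eq lt(1) Y'B(1) lt(2) _ B(2)] n eq ne'[of X] by simp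
    next
      case True
      then have Y1: "Y - 1 \<notin> B" using Y 2 eq by (auto simp: sd)
      \<comment> \<open>If \<open>Y'\<close> has the class of \<open>X - 1\<close>, then
        \<open>Y' + 1\<close> is also a gap of \<open>B\<close> and has class
        \<open>i\<close>.\<close>
      have "\<exists>Q. Q \<notin> B \<and> Q < X - 1 \<and> \<rho> Q \<noteq> \<rho> (X - 1)"
      proof (cases "\<rho> (Y' + 1) = i")
        case c: True
        then have "Y' + 1 \<notin> B" "\<rho> (Y' + 1) \<noteq> \<rho> (X - 1)" using Y'B ne'[of X] 2 by auto
        moreover from this have "Y' + 1 \<noteq> X" "Y' + 1 \<noteq> X - 1" using B by metis+
        then have "Y' + 1 < X - 1" using lt by linarith
        ultimately show ?thesis by blast
      next
        case c: False
        then have "\<rho> Y' \<noteq> \<rho> (X - 1)" using inj[of Y' "X - 1"] 2 by auto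
        moreover have "Y' \<noteq> X - 1" using Y'B B by auto
        ultimately show ?thesis using lt Y'B by (intro exI[of _ Y']) auto
      qed
      then obtain Q where Q: "Q \<notin> B" "Q < X - 1" "\<rho> Q \<noteq> \<rho> (X - 1)" by blast
      show False using no[OF B(2) Y1 eq1 _ Q B(1)] lt ne'[of X] eq1 by simp
    qed
  next
    case 3
    have Xi: "\<rho> X \<noteq> i" using 3 ne[of X] by auto
    have Yi: "\<rho> (Y + 1) = i" "\<rho> Y \<noteq> i" using 3 Xi eq inj[of X Y] by auto
    \<comment> \<open>Dually, \<open>Y + 1\<close> replaces \<open>Y'\<close> if \<open>X\<close> is
      a bead of \<open>B\<close>; otherwise the pair \<open>(X + 1, Y + 1)\<close> is used, with the
      gap \<open>X\<close> in place of \<open>Y'\<close>.\<close>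
    then have B: "Y \<notin> B" "Y + 1 \<notin> B" using Y by (auto simp: sd)
    have "\<rho> (X' + 1) \<noteq> i" using n(2) inj[of X' Y] Yi by auto
    then have X'B: "X' \<in> B" "\<rho> X' = i \<longrightarrow> X' - 1 \<in> B"
      using X' by (auto simp: sd split: if_splits)
    show False
    proof (cases "X \<in> B")
      case True
      have "Y + 1 \<noteq> X" using eq ne[of Y] by metis
      then have "Y + 1 < X" using lt by simp
      then show False using no[OF True B(1) eq lt(1) B(2) _ _ X'B(1) lt(3) n(2)] eq ne[of Y] by metis
    next
      case False
      then have X1: "X + 1 \<in> B" using X 3 Xi by (auto simp: sd)
      have eq1: "\<rho> (X + 1) = \<rho> (Y + 1)" using inj eq by blast
      have "\<exists>P. P \<in> B \<and> Y + 1 < P \<and> \<rho> P \<noteq> \<rho> (Y + 1)"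
      proof (cases "\<rho> X' = i")
        case c: True
        then have "X' - 1 \<in> B" "\<rho> (X' - 1) \<noteq> \<rho> (Y + 1)" using X'B ne'[of X'] Yi by auto
        moreover from this have "Y + 1 \<noteq> X'" "Y + 1 \<noteq> X' - 1" using X'B B by metis+
        ultimately show ?thesis using lt by (intro exI[of _ "X' - 1"]) simp
      next
        case c: False
        moreover have "Y + 1 \<noteq> X'" using X'B B by auto
        ultimately show ?thesis using lt Yi X'B by (intro exI[of _ X']) auto
      qed
      then obtain P where P: "P \<in> B" "Y + 1 < P" "\<rho> P \<noteq> \<rho> (Y + 1)" by blast
      show False using no[OF X1 B(2) eq1 _ False _ _ P] lt ne[of X] by auto
    qed
  qed
qed

text \<open>The bead of a nonempty row is the content of its last box. That box is removable exactly
  when the next row is shorter, that is, when the position below the bead is a gap; removing it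
  lowers the bead by 1.\<close>

lemma beads_diff_removable:
  assumes "2 \<le> l" and D: "young_diagram D"
  shows "beads (D - removable l i D) = shift_down (\<lambda>x. x mod int l) (int i) (beads D)"
proof -
  let ?R = "removable l i D"
  define \<beta> where "\<beta> a = int (row_length D a) - int a" for a
  have B: "x \<in> beads D \<longleftrightarrow> (\<exists>a\<ge>1. x = \<beta> a)" for x by (auto simp: beads_def \<beta>_def)
  have D': "young_diagram (D - ?R)" by (rule young_diagram_diff_removable[OF assms order_refl])
  have anti: "\<beta> c < \<beta> a" if "1 \<le> a" "a < c" for a c
    using row_length_antimono[OF D, of a c] that by (simp add: \<beta>_def)
  \<comment> \<open>For an empty row both sides are false, since the next row is empty too.\<close>
  have end_removable: "(a, row_length D a) \<in> ?R \<longleftrightarrow> \<beta> a mod int l = int i \<and> \<beta> a - 1 \<notin> beads D"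
    if a: "1 \<le> a" for a
  proof -
    have "\<beta> a - 1 \<in> beads D \<longleftrightarrow> row_length D (Suc a) = row_length D a"
    proof
      assume "\<beta> a - 1 \<in> beads D"
      then obtain c where c: "1 \<le> c" "\<beta> c = \<beta> a - 1" using B by metis
      have "a < c" using c anti[of c a] by (cases a c rule: linorder_cases) auto
      moreover have "\<not> Suc a < c" using anti[of "Suc a" c] anti[of a "Suc a"] a c by auto
      ultimately have "c = Suc a" by simp
      then show "row_length D (Suc a) = row_length D a" using c by (simp add: \<beta>_def)
    next
      assume "row_length D (Suc a) = row_length D a"
      then show "\<beta> a - 1 \<in> beads D" unfolding B by (intro exI[of _ "Suc a"]) (simp add: \<beta>_def)
    qed
    then show ?thesis
      using row_length_antimono[OF D a, of "Suc a"]
      by (auto simp: removable_iff[OF D] mem_iff_row[OF D] residue_def \<beta>_def)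
  qed
  have row: "int (row_length (D - ?R) a) - int a =
      (if \<beta> a mod int l = int i \<and> \<beta> a - 1 \<notin> beads D then \<beta> a - 1 else \<beta> a)" if a: "1 \<le> a" for a
  proof -
    let ?r = "row_length D a"
    \<comment> \<open>A removable box ends its row, so each row loses at most one box.\<close>
    have R: "(a, b) \<in> ?R \<longleftrightarrow> b = ?r \<and> (a, ?r) \<in> ?R" for b
      using removable_iff[OF D] mem_iff_row[OF D, of a] by (metis Suc_leI le_Suc_eq le_neq_implies_less not_less_eq_eq)
    have row': "{1..row_length (D - ?R) a} = {1..?r} - {b. (a, b) \<in> ?R}"
      using row_eq[OF D', of a] row_eq[OF D, of a] by blast
    have "row_length (D - ?R) a = (if (a, ?r) \<in> ?R then ?r - 1 else ?r)"
    proof (cases "(a, ?r) \<in> ?R")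
      case True
      then have "{b. (a, b) \<in> ?R} = {?r}" using R by blast
      moreover have "1 \<le> ?r" using True removable_iff[OF D] mem_iff_row[OF D] by blast
      ultimately have "card {1..row_length (D - ?R) a} = card {1..?r} - 1"
        using row' by (simp add: card_Diff_singleton)
      then show ?thesis using True by simp
    next
      case False
      then have "{b. (a, b) \<in> ?R} = {}" using R by blast
      then have "card {1..row_length (D - ?R) a} = card {1..?r}" using row' by (simp only: Diff_empty)
      then show ?thesis using False by simp
    qed
    moreover have "1 \<le> ?r" if "(a, ?r) \<in> ?R" using that removable_iff[OF D] mem_iff_row[OF D] by blast
    ultimately show ?thesis using end_removable[OF a] by (auto simp: \<beta>_def)
  qed
  have "(x + 1) mod int l \<noteq> x mod int l" for x :: int
    using assms(1) by (auto simp: mod_eq_dvd_iff)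
  note shift = shift_down_eq_image[where \<rho> = "\<lambda>x. x mod int l", OF this]
  define f where "f x = (if x mod int l = int i \<and> x - 1 \<notin> beads D then x - 1 else x)" for x
  have "beads (D - ?R) = (\<lambda>a. int (row_length (D - ?R) a) - int a) ` {1..}"
    by (auto simp: beads_def)
  also have "\<dots> = (\<lambda>a. f (\<beta> a)) ` {1..}"
    by (intro image_cong refl) (simp only: row f_def atLeast_iff)
  also have "\<dots> = f ` beads D"
  proof -
    have "beads D = \<beta> ` {1..}" by (auto simp: beads_def \<beta>_def)
    then show ?thesis by (simp only: image_image)
  qed
  finally show ?thesis unfolding shift f_def .
qed

lemma JM_partition_diff_removable:
  assumes "2 \<le> l" "JM_partition l D"
  shows "JM_partition l (D - removable l i D)"
proof -
  have D: "young_diagram D" using assms(2) by (simp add: JM_partition_def)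
  have "JM_beads (\<lambda>x. x mod int l) (shift_down (\<lambda>x. x mod int l) (int i) (beads D))"
  proof (rule JM_beads_shift_down)
    show "(x + 1) mod int l = (y + 1) mod int l \<longleftrightarrow> x mod int l = y mod int l" for x y :: int
      by (simp add: mod_eq_dvd_iff)
    show "(x + 1) mod int l \<noteq> x mod int l" for x :: int
      using assms(1) by (auto simp: mod_eq_dvd_iff)
    show "JM_beads (\<lambda>x. x mod int l) (beads D)" using JM_partition_iff_beads[OF D] assms(2) by simp
  qed
  then show ?thesis
    using JM_partition_iff_beads[OF young_diagram_diff_removable[OF assms(1) D order_refl]]
    by (simp add: beads_diff_removable[OF assms(1) D])
qed

section \<open>Rebuilding the partition by crystal operators\<close>

text \<open>A box with the largest sum of row and column has neither a lower nor a right
  neighbour.\<close>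

lemma ex_removable:
  assumes "2 \<le> l" and D: "young_diagram D" and "D \<noteq> {}"
  shows "\<exists>i<l. removable l i D \<noteq> {}"
proof -
  have "finite D" using D by (simp add: young_diagram_def)
  then obtain p where p: "p \<in> D" "\<And>q. q \<in> D \<Longrightarrow> fst q + snd q \<le> fst p + snd p"
    using assms(3) Max_in[of "(\<lambda>q. fst q + snd q) ` D"] Max_ge[of "(\<lambda>q. fst q + snd q) ` D"]
    by (smt (verit) finite_imageI image_iff image_is_empty)
  obtain a b where ab: "p = (a, b)" by force
  have "(Suc a, b) \<notin> D" "(a, Suc b) \<notin> D" using p(2)[of "(Suc a, b)"] p(2)[of "(a, Suc b)"] ab by auto
  moreover define i where "i = nat (residue l p)"
  moreover have "0 \<le> residue l p" "residue l p < int l" using assms(1) by (auto simp: residue_def ab)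
  ultimately have "p \<in> removable l i D" "i < l" using p(1) ab by (auto simp: removable_iff[OF D])
  then show ?thesis by blast
qed

text \<open>The boxes return from the last in ladder order to the first. When \<open>t\<close> is
  due, the missing boxes and the addable boxes of \<open>D\<close> precede it and the restored ones
  follow it, so \<open>t\<close> is the cogood box.\<close>

lemma ladder_crystal_restore:
  assumes "3 \<le> l" "i < l" "JM_partition l D" "D - removable l i D \<in> ladder_crystal l"
  shows "D \<in> ladder_crystal l"
proof -
  let ?R = "removable l i D" and ?k = "ladder_key l"
  have l2: "2 \<le> l" using assms(1) by simp
  have D: "young_diagram D" using assms(3) by (simp add: JM_partition_def)
  have finR: "finite ?R" using finite_corners[OF D] by simp
  have inj: "inj ?k" using assms(1) by (auto simp: inj_def ladder_key_def ladder_number_def)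
  \<comment> \<open>\<open>T\<close> holds the boxes still missing, always an initial segment of
    \<open>?R\<close> in ladder order; the base case is \<open>T = ?R\<close> and the goal is
    \<open>T = {}\<close>.\<close>
  have "D - T \<in> ladder_crystal l"
    if "T \<subseteq> ?R" "\<And>t r. t \<in> T \<Longrightarrow> r \<in> ?R - T \<Longrightarrow> ?k t < ?k r" for T
    using that
  proof (induction "card (?R - T)" arbitrary: T rule: less_induct)
    case less
    show ?case
    proof (cases "?R - T = {}")
      case True
      then have "T = ?R" using less.prems by blast
      then show ?thesis using assms(4) by simp
    next
      case False
      then obtain t where t: "t \<in> ?R - T" "\<And>r. r \<in> ?R - T \<Longrightarrow> ?k t \<le> ?k r"
        using arg_min_if_finite[of "?R - T" ?k] finR by (metis finite_Diff not_le)
      let ?T = "insert t T"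
      have min: "?k t < ?k r" if "r \<in> ?R - ?T" for r
        using t(2)[of r] that injD[OF inj, of t r] by (auto simp: order.order_iff_strict)
      have sub: "?T \<subseteq> ?R" using less.prems t by blast
      have "card (?R - ?T) < card (?R - T)"
        using t finR by (intro psubset_card_mono) auto
      then have mem: "D - ?T \<in> ladder_crystal l"
        using less.hyps[OF _ sub] less.prems(2) min by blast
      note add = addable_diff_removable[OF l2 D sub] and rem = removable_diff_removable[OF l2 D sub]
      have "f_hat l i (D - ?T) = Some (insert t (D - ?T))"
      proof (rule f_hat_eq[OF l2 young_diagram_diff_removable[OF l2 D sub]])
        show "t \<in> addable l i (D - ?T)" using add by simp
        show "?k q < ?k t" if "q \<in> addable l i (D - ?T)" "q \<noteq> t" for q
          using that add less.prems(2)[of q t] t addable_before_removable[OF assms(1,3), of q i t] by auto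
        show "?k t < ?k q" if "q \<in> removable l i (D - ?T)" for q
          using that rem min by simp
      qed
      moreover have "insert t (D - ?T) = D - T" using t by (auto simp: removable_def)
      ultimately show ?thesis using ladder_crystal.step[OF mem assms(2)] by simp
    qed
  qed
  from this[of "{}"] show ?thesis by simp
qed

theorem theorem8p7:
  fixes l :: nat and D :: "box set"
  assumes "3 \<le> l" and "JM_partition l D"
  shows "D \<in> ladder_crystal l"
  using assms(2)
proof (induction "card D" arbitrary: D rule: less_induct)
  case less
  have l2: "2 \<le> l" using assms(1) by simp
  have D: "young_diagram D" using less.prems by (simp add: JM_partition_def)
  show ?case
  proof (cases "D = {}")
    case False
    then obtain i where i: "i < l" "removable l i D \<noteq> {}" using ex_removable[OF l2 D] by blast
    have "finite D" using D by (simp add: young_diagram_def)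
    then have "card (D - removable l i D) < card D"
      using i by (intro psubset_card_mono) (auto simp: removable_def)
    then have "D - removable l i D \<in> ladder_crystal l"
      using less.hyps JM_partition_diff_removable[OF l2 less.prems] by blast
    then show ?thesis by (rule ladder_crystal_restore[OF assms(1) i(1) less.prems])
  qed (simp add: ladder_crystal.empty)
qed

end
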